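(* There exist an integer $d\geq 2$ and a complex-linear map $\Phi:\mathbb C^{d\times d}\to\mathbb C^{d\times d}$ which is positive and trace-preserving but satisfies $$\mathrm{tr}(\Phi)> d\,\min\Re(\sigma(\Phi))+(d^2-d).$$ Specifically, this holds for $d=2$ and the transpose map $\Phi(X)=X^T$, which is positive but not 2-positive.
   Context: $\mathbb C^{d\times d}$ is the space of complex $d\times d$ matrices. A linear map $\Phi:\mathbb C^{d\times d}\to\mathbb C^{d\times d}$ is positive if $\Phi(A)$ is positive semi-definite whenever $A$ is positive semi-definite. It is 2-positive if the extended map $\mathrm{id}_2\otimes\Phi:\mathbb C^{2\times 2}\otimes\mathbb C^{d\times d}\to\mathbb C^{2\times 2}\otimes\mathbb C^{d\times d}$, determined by $(\mathrm{id}_2\otimes\Phi)(A\otimes B)=A\otimes\Phi(B)$, is positive. It is trace-preserving if $\mathrm{tr}(\Phi(X))=\mathrm{tr}(X)$ for all $X\in\mathbb C^{d\times d}$. Here $\mathrm{tr}(\Phi)$ is the trace of $\Phi$ as a linear operator on the $d^2$-dimensional complex vector space $\mathbb C^{d\times d}$ (it is a real number for every positive $\Phi$), $\sigma(\Phi)$ is the spectrum of $\Phi$ as such an operator, and $\min\Re(\sigma(\Phi))$ is the smallest real part of any eigenvalue of $\Phi$. *)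

theory Defs
  imports "Jordan_Normal_Form.Spectral_Radius" "Jordan_Normal_Form.VS_Connect"
begin

abbreviation linear_op :: "nat \<Rightarrow> (complex mat \<Rightarrow> complex mat) \<Rightarrow> bool" where
  "linear_op d \<Phi> \<equiv>
     linear_map class_ring (module_mat TYPE(complex) d d) (module_mat TYPE(complex) d d) \<Phi>"

definition psd :: "nat \<Rightarrow> complex mat \<Rightarrow> bool" where
  "psd n A \<longleftrightarrow> A \<in> carrier_mat n n \<and> mat_adjoint A = A \<and>
     (\<forall>v \<in> carrier_vec n. 0 \<le> Re ((A *\<^sub>v v) \<bullet>c v))"

definition positive_map :: "nat \<Rightarrow> (complex mat \<Rightarrow> complex mat) \<Rightarrow> bool" where
  "positive_map d \<Phi> \<longleftrightarrow> (\<forall>A. psd d A \<longrightarrow> psd d (\<Phi> A))"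

definition kron :: "complex mat \<Rightarrow> complex mat \<Rightarrow> complex mat" where
  "kron A B = mat (dim_row A * dim_row B) (dim_col A * dim_col B)
     (\<lambda>(r, c). A $$ (r div dim_row B, c div dim_col B) * B $$ (r mod dim_row B, c mod dim_col B))"

definition mat_block :: "nat \<Rightarrow> complex mat \<Rightarrow> nat \<Rightarrow> nat \<Rightarrow> complex mat" where
  "mat_block d X a b = mat d d (\<lambda>(i, j). X $$ (a * d + i, b * d + j))"

text \<open>The tensor product of the \<open>k \<times> k\<close> and the \<open>d \<times> d\<close> matrices is identified with the
  \<open>kd \<times> kd\<close> matrices through \<^const>\<open>kron\<close>; then \<open>id \<otimes> \<Phi>\<close> applies \<open>\<Phi>\<close> to every \<open>d \<times> d\<close>
  block. That this is the linear map determined by \<open>A \<otimes> B \<mapsto> A \<otimes> \<Phi> B\<close> is proved in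
  \<open>linear_op_id_tensor\<close>, \<open>id_tensor_kron\<close> and \<open>id_tensor_unique\<close>.\<close>

definition id_tensor :: "nat \<Rightarrow> nat \<Rightarrow> (complex mat \<Rightarrow> complex mat) \<Rightarrow> complex mat \<Rightarrow> complex mat" where
  "id_tensor k d \<Phi> X = mat (k * d) (k * d)
     (\<lambda>(r, c). \<Phi> (mat_block d X (r div d) (c div d)) $$ (r mod d, c mod d))"

definition two_positive :: "nat \<Rightarrow> (complex mat \<Rightarrow> complex mat) \<Rightarrow> bool" where
  "two_positive d \<Phi> \<longleftrightarrow> positive_map (2 * d) (id_tensor 2 d \<Phi>)"

definition mat_trace :: "complex mat \<Rightarrow> complex" where
  "mat_trace A = (\<Sum>i < dim_row A. A $$ (i, i))"

definition trace_preserving :: "nat \<Rightarrow> (complex mat \<Rightarrow> complex mat) \<Rightarrow> bool" where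
  "trace_preserving d \<Phi> \<longleftrightarrow> (\<forall>X \<in> carrier_mat d d. mat_trace (\<Phi> X) = mat_trace X)"

definition mat_unit :: "nat \<Rightarrow> nat \<Rightarrow> nat \<Rightarrow> complex mat" where
  "mat_unit d i j = mat d d (\<lambda>(k, l). if k = i \<and> l = j then 1 else 0)"

text \<open>The \<open>d\<^sup>2 \<times> d\<^sup>2\<close> matrix of \<open>\<Phi>\<close> in the basis of matrix units, the unit at \<open>(i, j)\<close>
  having index \<open>i * d + j\<close>.\<close>

definition op_mat :: "nat \<Rightarrow> (complex mat \<Rightarrow> complex mat) \<Rightarrow> complex mat" where
  "op_mat d \<Phi> = mat (d * d) (d * d)
     (\<lambda>(r, c). \<Phi> (mat_unit d (c div d) (c mod d)) $$ (r div d, r mod d))"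

definition op_trace :: "nat \<Rightarrow> (complex mat \<Rightarrow> complex mat) \<Rightarrow> complex" where
  "op_trace d \<Phi> = mat_trace (op_mat d \<Phi>)"

definition op_spectrum :: "nat \<Rightarrow> (complex mat \<Rightarrow> complex mat) \<Rightarrow> complex set" where
  "op_spectrum d \<Phi> =
     {z. \<exists>X \<in> carrier_mat d d. X \<noteq> 0\<^sub>m d d \<and> \<Phi> X = z \<cdot>\<^sub>m X}"

lemma linear_op_iff:
  "linear_op d \<Phi> \<longleftrightarrow>
     (\<forall>X \<in> carrier_mat d d. \<Phi> X \<in> carrier_mat d d) \<and>
     (\<forall>X \<in> carrier_mat d d. \<forall>Y \<in> carrier_mat d d. \<Phi> (X + Y) = \<Phi> X + \<Phi> Y) \<and>
     (\<forall>z. \<forall>X \<in> carrier_mat d d. \<Phi> (z \<cdot>\<^sub>m X) = z \<cdot>\<^sub>m \<Phi> X)"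
proof -
  have vs: "vectorspace class_ring (module_mat TYPE(complex) d d)"
    by (rule matrix_vs)
  then have "module class_ring (module_mat TYPE(complex) d d)"
    by (simp add: vectorspace_def)
  with vs show ?thesis
    by (auto simp: linear_map_def mod_hom_def mod_hom_axioms_def module_hom_def matrix_vs_simps)
qed

lemma mat_unit_carrier [simp]: "mat_unit d i j \<in> carrier_mat d d"
  by (simp add: mat_unit_def)

lemma linear_op_expand:
  assumes lin: "linear_op d \<Phi>" and X: "X \<in> carrier_mat d d" and ij: "i < d" "j < d"
  shows "\<Phi> X $$ (i, j) = (\<Sum>(k, l) \<in> {..<d} \<times> {..<d}. X $$ (k, l) * \<Phi> (mat_unit d k l) $$ (i, j))"
proof -
  note L = lin[unfolded linear_op_iff]
  define R where "R S = mat d d (\<lambda>p. if p \<in> S then X $$ p else 0)" for S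
  have R: "R S \<in> carrier_mat d d" for S
    by (simp add: R_def)
  have "\<Phi> (R S) $$ (i, j) = (\<Sum>(k, l) \<in> S. X $$ (k, l) * \<Phi> (mat_unit d k l) $$ (i, j))"
    if "finite S" "S \<subseteq> {..<d} \<times> {..<d}" for S
    using that
  proof (induction S rule: finite_induct)
    case empty
    have "R {} = 0 \<cdot>\<^sub>m R {}"
      by (auto simp: R_def)
    then have "\<Phi> (R {}) = 0 \<cdot>\<^sub>m \<Phi> (R {})"
      using L R by metis
    moreover have "\<Phi> (R {}) \<in> carrier_mat d d"
      using L R by blast
    ultimately have "\<Phi> (R {}) $$ (i, j) = 0 * \<Phi> (R {}) $$ (i, j)"
      using ij by (metis carrier_matD index_smult_mat(1))
    then show ?case
      by simp
  next
    case (insert p S)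
    obtain k l where p: "p = (k, l)"
      by fastforce
    have "R (insert p S) = X $$ (k, l) \<cdot>\<^sub>m mat_unit d k l + R S"
      using insert.hyps p by (intro eq_matI) (auto simp: R_def mat_unit_def)
    then have "\<Phi> (R (insert p S)) = X $$ (k, l) \<cdot>\<^sub>m \<Phi> (mat_unit d k l) + \<Phi> (R S)"
      using L R by simp
    moreover have "\<Phi> (mat_unit d k l) \<in> carrier_mat d d" "\<Phi> (R S) \<in> carrier_mat d d"
      using L R by simp_all
    ultimately show ?case
      using insert p ij by simp
  qed
  note this[of "{..<d} \<times> {..<d}"]
  moreover have "R ({..<d} \<times> {..<d}) = X"
    using X by (intro eq_matI) (auto simp: R_def)
  ultimately show ?thesis
    by simp
qed

lemma id_tensor_index: "a * d + i < k * d" if "a < k" "i < d" for a k i d :: nat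
proof -
  have "a * d + i < Suc a * d"
    using that by simp
  also have "\<dots> \<le> k * d"
    using that by (intro mult_le_mono1) simp
  finally show ?thesis .
qed

lemma div_mod_index: "r div d < k" "r mod d < d" if "r < k * d" for r d k :: nat
  using that by (cases "d = 0", simp_all add: less_mult_imp_div_less)+

lemma mat_block_carrier [simp]: "mat_block d X a b \<in> carrier_mat d d"
  by (simp add: mat_block_def)

lemma linear_op_id_tensor:
  assumes lin: "linear_op d \<Phi>"
  shows "linear_op (k * d) (id_tensor k d \<Phi>)"
proof -
  note L = lin[unfolded linear_op_iff]
  have dims: "dim_row (\<Phi> (mat_block d X a b)) = d" "dim_col (\<Phi> (mat_block d X a b)) = d" for X a b
    using L mat_block_carrier by (blast dest: carrier_matD)+
  have add: "mat_block d (X + Y) a b = mat_block d X a b + mat_block d Y a b"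
    if "X \<in> carrier_mat (k * d) (k * d)" "Y \<in> carrier_mat (k * d) (k * d)" "a < k" "b < k" for X Y a b
    using that by (intro eq_matI) (auto simp: mat_block_def id_tensor_index)
  have smult: "mat_block d (z \<cdot>\<^sub>m X) a b = z \<cdot>\<^sub>m mat_block d X a b"
    if "X \<in> carrier_mat (k * d) (k * d)" "a < k" "b < k" for X z a b
    using that by (intro eq_matI) (auto simp: mat_block_def id_tensor_index)
  show ?thesis
    unfolding linear_op_iff
  proof (intro conjI ballI allI)
    show "id_tensor k d \<Phi> X \<in> carrier_mat (k * d) (k * d)" for X
      by (simp add: id_tensor_def)
    show "id_tensor k d \<Phi> (X + Y) = id_tensor k d \<Phi> X + id_tensor k d \<Phi> Y"
      if "X \<in> carrier_mat (k * d) (k * d)" "Y \<in> carrier_mat (k * d) (k * d)" for X Y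
      using that L by (intro eq_matI) (simp_all add: id_tensor_def add div_mod_index dims)
    show "id_tensor k d \<Phi> (z \<cdot>\<^sub>m X) = z \<cdot>\<^sub>m id_tensor k d \<Phi> X"
      if "X \<in> carrier_mat (k * d) (k * d)" for z X
      using that L by (intro eq_matI) (simp_all add: id_tensor_def smult div_mod_index dims)
  qed
qed

lemma id_tensor_kron:
  assumes lin: "linear_op d \<Phi>" and A: "A \<in> carrier_mat k k" and B: "B \<in> carrier_mat d d"
  shows "id_tensor k d \<Phi> (kron A B) = kron A (\<Phi> B)"
proof -
  note L = lin[unfolded linear_op_iff]
  have \<Phi>B: "\<Phi> B \<in> carrier_mat d d"
    using L B by blast
  have blk: "mat_block d (kron A B) a b = A $$ (a, b) \<cdot>\<^sub>m B" if "a < k" "b < k" for a b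
    using that A B by (intro eq_matI) (auto simp: mat_block_def kron_def id_tensor_index)
  show ?thesis
  proof (rule eq_matI)
    fix r c assume "r < dim_row (kron A (\<Phi> B))" "c < dim_col (kron A (\<Phi> B))"
    then have rc: "r < k * d" "c < k * d"
      using A \<Phi>B by (simp_all add: kron_def)
    note i = div_mod_index[OF rc(1)] div_mod_index[OF rc(2)]
    have "id_tensor k d \<Phi> (kron A B) $$ (r, c)
        = (A $$ (r div d, c div d) \<cdot>\<^sub>m \<Phi> B) $$ (r mod d, c mod d)"
      using rc i L B by (simp add: id_tensor_def blk)
    also have "\<dots> = kron A (\<Phi> B) $$ (r, c)"
      using rc i A \<Phi>B by (simp add: kron_def)
    finally show "id_tensor k d \<Phi> (kron A B) $$ (r, c) = kron A (\<Phi> B) $$ (r, c)" .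
  qed (use A \<Phi>B in \<open>simp_all add: id_tensor_def kron_def\<close>)
qed

lemma id_tensor_unique:
  assumes lin: "linear_op d \<Phi>" and lin': "linear_op (k * d) \<Psi>"
    and kron: "\<And>A B. A \<in> carrier_mat k k \<Longrightarrow> B \<in> carrier_mat d d \<Longrightarrow> \<Psi> (kron A B) = kron A (\<Phi> B)"
    and X: "X \<in> carrier_mat (k * d) (k * d)"
  shows "\<Psi> X = id_tensor k d \<Phi> X"
proof -
  have E: "mat_unit (k * d) r c = kron (mat_unit k (r div d) (c div d)) (mat_unit d (r mod d) (c mod d))"
    for r c
  proof (rule eq_matI)
    fix x y
    assume "x < dim_row (kron (mat_unit k (r div d) (c div d)) (mat_unit d (r mod d) (c mod d)))"
      "y < dim_col (kron (mat_unit k (r div d) (c div d)) (mat_unit d (r mod d) (c mod d)))"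
    then have xy: "x < k * d" "y < k * d"
      by (simp_all add: kron_def mat_unit_def)
    have "x = r \<longleftrightarrow> x div d = r div d \<and> x mod d = r mod d"
      "y = c \<longleftrightarrow> y div d = c div d \<and> y mod d = c mod d"
      by (metis div_mult_mod_eq)+
    then show "mat_unit (k * d) r c $$ (x, y)
        = kron (mat_unit k (r div d) (c div d)) (mat_unit d (r mod d) (c mod d)) $$ (x, y)"
      using xy div_mod_index[OF xy(1)] div_mod_index[OF xy(2)]
      by (auto simp: mat_unit_def kron_def)
  qed (simp_all add: mat_unit_def kron_def)
  have eq: "\<Psi> (mat_unit (k * d) r c) = id_tensor k d \<Phi> (mat_unit (k * d) r c)" for r c
    unfolding E by (simp add: kron id_tensor_kron[OF lin])
  note lin2 = linear_op_id_tensor[OF lin, of k]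
  have "\<Psi> X \<in> carrier_mat (k * d) (k * d)" "id_tensor k d \<Phi> X \<in> carrier_mat (k * d) (k * d)"
    using lin' lin2 X unfolding linear_op_iff by blast+
  then show ?thesis
    by (intro eq_matI) (auto simp: linear_op_expand[OF lin' X] linear_op_expand[OF lin2 X] eq)
qed

lemma op_trace_eq:
  "op_trace d \<Phi> = (\<Sum>i<d. \<Sum>j<d. \<Phi> (mat_unit d i j) $$ (i, j))"
proof -
  have "(\<Sum>i<d. \<Sum>j<d. \<Phi> (mat_unit d i j) $$ (i, j))
      = (\<Sum>(i, j) \<in> {..<d} \<times> {..<d}. \<Phi> (mat_unit d i j) $$ (i, j))"
    by (simp add: sum.cartesian_product)
  also have "\<dots> = (\<Sum>r < d * d. \<Phi> (mat_unit d (r div d) (r mod d)) $$ (r div d, r mod d))"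
    by (rule sum.reindex_bij_witness[where j = "\<lambda>(i, j). i * d + j" and i = "\<lambda>r. (r div d, r mod d)"])
      (auto simp: id_tensor_index div_mod_index)
  finally show ?thesis
    by (simp add: op_trace_def mat_trace_def op_mat_def)
qed

text \<open>The trace of a positive map is real and the spectrum is finite and nonempty, so \<open>Re\<close> of the
  trace and \<open>Min\<close> of the real parts of the spectrum lose nothing.\<close>

lemma psd_rank_one:
  assumes "w \<in> carrier_vec d"
  shows "psd d (mat d d (\<lambda>(k, l). w $ k * cnj (w $ l)))" (is "psd d ?A")
  unfolding psd_def
proof (intro conjI ballI)
  show "?A \<in> carrier_mat d d"
    by simp
  show "mat_adjoint ?A = ?A"
    by (intro eq_matI) (auto simp: mat_adjoint_def mat_of_rows_def)
  fix v :: "complex vec" assume v: "v \<in> carrier_vec d"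
  define s where "s = (\<Sum>l<d. cnj (w $ l) * v $ l)"
  have "(?A *\<^sub>v v) \<bullet>c v = (\<Sum>k<d. (\<Sum>l<d. w $ k * cnj (w $ l) * v $ l) * cnj (v $ k))"
    using v by (auto simp: scalar_prod_def atLeast0LessThan intro!: sum.cong)
  also have "\<dots> = (\<Sum>k<d. w $ k * cnj (v $ k)) * s"
    by (simp add: s_def sum_distrib_left sum_distrib_right mult_ac)
  also have "(\<Sum>k<d. w $ k * cnj (v $ k)) = cnj s"
    by (simp add: s_def)
  finally show "0 \<le> Re ((?A *\<^sub>v v) \<bullet>c v)"
    by simp
qed

lemma psd_adjoint: "psd d A \<Longrightarrow> i < d \<Longrightarrow> j < d \<Longrightarrow> A $$ (j, i) = cnj (A $$ (i, j))"
proof -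
  assume A: "psd d A" "i < d" "j < d"
  then have "A \<in> carrier_mat d d"
    by (simp add: psd_def)
  with A(2,3) have "mat_adjoint A $$ (j, i) = cnj (A $$ (i, j))"
    by (simp add: mat_adjoint_def mat_of_rows_def)
  with A show ?thesis
    by (simp add: psd_def)
qed

lemma op_trace_real:
  assumes lin: "linear_op d \<Phi>" and pos: "positive_map d \<Phi>"
  shows "op_trace d \<Phi> \<in> \<real>"
proof -
  note L = lin[unfolded linear_op_iff]
  define c where "c i j = \<Phi> (mat_unit d i j)" for i j
  have carr: "c i j \<in> carrier_mat d d" for i j
    using L by (simp add: c_def)
  have adj: "c j i $$ (j, i) = cnj (c i j $$ (i, j))" if ij: "i < d" "j < d" for i j
  proof -
    have herm: "\<Phi> A $$ (j, i) = cnj (\<Phi> A $$ (i, j))" if "psd d A" for A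
      using psd_adjoint pos ij that unfolding positive_map_def by blast
    have unit: "c k k $$ (j, i) = cnj (c k k $$ (i, j))" if "k < d" for k
    proof -
      have "mat_unit d k k = mat d d (\<lambda>(a, b). unit_vec d k $ a * cnj (unit_vec d k $ b))"
        using that by (intro eq_matI) (auto simp: mat_unit_def)
      then show ?thesis
        using herm psd_rank_one[of "unit_vec d k" d] by (simp add: c_def)
    qed
    show ?thesis
    proof (cases "i = j")
      case True
      then show ?thesis
        using unit[OF ij(1)] by metis
    next
      case False
      have comb: "c i j $$ (j, i) * cnj u + c j i $$ (j, i) * u
          = cnj (c i j $$ (i, j) * cnj u + c j i $$ (i, j) * u)" if u: "u * cnj u = 1" for u
      proof -
        define w where "w = unit_vec d i + u \<cdot>\<^sub>v unit_vec d j"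
        define A where "A = mat d d (\<lambda>(k, l). w $ k * cnj (w $ l))"
        have "w \<in> carrier_vec d" by (simp add: w_def)
        then have "psd d A" unfolding A_def by (rule psd_rank_one)
        note h = herm[OF this]
        have "A = (mat_unit d i i + mat_unit d j j) + (cnj u \<cdot>\<^sub>m mat_unit d i j + u \<cdot>\<^sub>m mat_unit d j i)"
          using ij False u by (intro eq_matI) (auto simp: A_def w_def mat_unit_def)
        then have "\<Phi> A = (c i i + c j j) + (cnj u \<cdot>\<^sub>m c i j + u \<cdot>\<^sub>m c j i)"
          using L by (simp add: c_def)
        then have "\<Phi> A $$ (a, b) = c i i $$ (a, b) + c j j $$ (a, b)
            + (cnj u * c i j $$ (a, b) + u * c j i $$ (a, b))" if "a < d" "b < d" for a b
          using that carr[THEN carrier_matD(1)] carr[THEN carrier_matD(2)] by simp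
        with h ij unit[of i] unit[of j] show ?thesis
          by (simp add: mult.commute)
      qed
      from comb[of 1] comb[of \<i>] show ?thesis
        by (simp add: complex_eq_iff)
    qed
  qed
  have "cnj (op_trace d \<Phi>) = (\<Sum>i<d. \<Sum>j<d. cnj (c i j $$ (i, j)))"
    by (simp add: op_trace_eq c_def)
  also have "\<dots> = (\<Sum>i<d. \<Sum>j<d. c j i $$ (j, i))"
    by (intro sum.cong refl) (simp add: adj[symmetric])
  also have "\<dots> = op_trace d \<Phi>"
    by (subst sum.swap) (simp add: op_trace_eq c_def)
  finally show ?thesis
    by (simp add: complex_is_Real_iff complex_eq_iff)
qed

lemma op_spectrum_eq:
  assumes lin: "linear_op d \<Phi>"
  shows "op_spectrum d \<Phi> = spectrum (op_mat d \<Phi>)"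
proof -
  note L = lin[unfolded linear_op_iff]
  define flat where "flat X = vec (d * d) (\<lambda>r. X $$ (r div d, r mod d))" for X :: "complex mat"
  have flat_inj: "X = Y" if "X \<in> carrier_mat d d" "Y \<in> carrier_mat d d" "flat X = flat Y" for X Y
  proof (rule eq_matI)
    fix i j assume "i < dim_row Y" "j < dim_col Y"
    with that have ij: "i < d" "j < d" by auto
    then have "flat X $ (i * d + j) = X $$ (i, j)" "flat Y $ (i * d + j) = Y $$ (i, j)"
      by (simp_all add: flat_def id_tensor_index)
    with that show "X $$ (i, j) = Y $$ (i, j)" by simp
  qed (use that in auto)
  have flat_op: "op_mat d \<Phi> *\<^sub>v flat X = flat (\<Phi> X)" if X: "X \<in> carrier_mat d d" for X
  proof (rule eq_vecI)
    fix r assume "r < dim_vec (flat (\<Phi> X))"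
    then have r: "r < d * d" by (simp add: flat_def)
    have "flat (\<Phi> X) $ r = (\<Sum>(k, l) \<in> {..<d} \<times> {..<d}.
        X $$ (k, l) * \<Phi> (mat_unit d k l) $$ (r div d, r mod d))"
      using r div_mod_index[OF r] by (simp add: flat_def linear_op_expand[OF lin X])
    also have "\<dots> = (\<Sum>s < d * d. X $$ (s div d, s mod d)
        * \<Phi> (mat_unit d (s div d) (s mod d)) $$ (r div d, r mod d))"
      by (rule sum.reindex_bij_witness[where j = "\<lambda>(i, j). i * d + j" and i = "\<lambda>r. (r div d, r mod d)"])
        (auto simp: id_tensor_index div_mod_index)
    also have "\<dots> = (op_mat d \<Phi> *\<^sub>v flat X) $ r"
      using r by (auto simp: op_mat_def flat_def scalar_prod_def atLeast0LessThan intro!: sum.cong)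
    finally show "(op_mat d \<Phi> *\<^sub>v flat X) $ r = flat (\<Phi> X) $ r" ..
  qed (simp add: op_mat_def flat_def)
  have flat_smult: "flat (z \<cdot>\<^sub>m X) = z \<cdot>\<^sub>v flat X" if "X \<in> carrier_mat d d" for z X
    using that by (auto simp: flat_def div_mod_index)
  have flat_zero: "flat (0\<^sub>m d d) = 0\<^sub>v (d * d)"
    by (auto simp: flat_def div_mod_index)
  have flat_surj: "\<exists>X \<in> carrier_mat d d. flat X = v" if "v \<in> carrier_vec (d * d)" for v
    using that by (intro bexI[of _ "mat d d (\<lambda>(i, j). v $ (i * d + j))"]) (auto simp: flat_def div_mod_index)
  have flat_eq: "\<Phi> X = z \<cdot>\<^sub>m X \<longleftrightarrow> op_mat d \<Phi> *\<^sub>v flat X = z \<cdot>\<^sub>v flat X"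
    "X \<noteq> 0\<^sub>m d d \<longleftrightarrow> flat X \<noteq> 0\<^sub>v (d * d)" "flat X \<in> carrier_vec (d * d)"
    if X: "X \<in> carrier_mat d d" for X z
  proof -
    have "\<Phi> X \<in> carrier_mat d d" "z \<cdot>\<^sub>m X \<in> carrier_mat d d" using L X by auto
    then show "\<Phi> X = z \<cdot>\<^sub>m X \<longleftrightarrow> op_mat d \<Phi> *\<^sub>v flat X = z \<cdot>\<^sub>v flat X"
      using flat_inj by (metis flat_op flat_smult X)
    show "X \<noteq> 0\<^sub>m d d \<longleftrightarrow> flat X \<noteq> 0\<^sub>v (d * d)"
      using flat_inj by (metis flat_zero X zero_carrier_mat)
  qed (simp add: flat_def)
  have "dim_row (op_mat d \<Phi>) = d * d" by (simp add: op_mat_def)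
  then show ?thesis
    unfolding op_spectrum_def spectrum_def eigenvalue_def eigenvector_def
    using flat_eq flat_surj by (auto, metis+)
qed

lemma op_spectrum_finite_nonempty:
  assumes "linear_op d \<Phi>" and "d > 0"
  shows "finite (op_spectrum d \<Phi>)" and "op_spectrum d \<Phi> \<noteq> {}"
proof -
  have "op_mat d \<Phi> \<in> carrier_mat (d * d) (d * d)"
    by (simp add: op_mat_def)
  with assms show "finite (op_spectrum d \<Phi>)" "op_spectrum d \<Phi> \<noteq> {}"
    by (auto simp: op_spectrum_eq dest: card_finite_spectrum spectrum_non_empty)
qed

end

theory Submission
  imports Defs
begin

lemma linear_op_transpose: "linear_op d transpose_mat"
  unfolding linear_op_iff by (auto simp: transpose_add)

text \<open>Moving the matrix across the bilinear product turns the quadratic form of the transpose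
  at \<open>v\<close> into that of \<open>A\<close> at \<open>conjugate v\<close>, which is
  nonnegative by assumption.\<close>

lemma psd_transpose:
  assumes A: "psd d A"
  shows "psd d (transpose_mat A)"
  unfolding psd_def
proof (intro conjI ballI)
  have carr: "A \<in> carrier_mat d d"
    using A by (simp add: psd_def)
  then show "transpose_mat A \<in> carrier_mat d d"
    by simp
  show "mat_adjoint (transpose_mat A) = transpose_mat A"
    using carr psd_adjoint[OF A, symmetric]
    by (intro eq_matI) (auto simp: mat_adjoint_def mat_of_rows_def)
  fix v :: "complex vec" assume v: "v \<in> carrier_vec d"
  then have w: "conjugate v \<in> carrier_vec d"
    by simp
  have "(transpose_mat A *\<^sub>v v) \<bullet>c v = v \<bullet> (A *\<^sub>v conjugate v)"
    using carr w v by (rule transpose_vec_mult_scalar)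
  also have "\<dots> = (A *\<^sub>v conjugate v) \<bullet>c conjugate v"
    using carr v w by (simp add: comm_scalar_prod[of v d])
  finally show "0 \<le> Re ((transpose_mat A *\<^sub>v v) \<bullet>c v)"
    using A w unfolding psd_def by metis
qed

lemma positive_map_transpose: "positive_map d transpose_mat"
  by (simp add: positive_map_def psd_transpose)

lemma trace_preserving_transpose: "trace_preserving d transpose_mat"
  by (auto simp: trace_preserving_def mat_trace_def)

text \<open>Transposition permutes the matrix units and fixes exactly the diagonal ones.\<close>

lemma op_trace_transpose: "op_trace d transpose_mat = of_nat d"
proof -
  have "op_trace d transpose_mat = (\<Sum>i<d. \<Sum>j<d. if j = i then 1 else 0)"
    unfolding op_trace_eq by (intro sum.cong refl) (auto simp: mat_unit_def)
  then show ?thesis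
    by simp
qed

text \<open>Antisymmetric matrices are eigenvectors for the eigenvalue -1, and nonzero ones exist
  once d \<ge> 2. An upper bound on the minimum is what the strict inequality calls for.\<close>

lemma Min_spectrum_transpose_le:
  assumes "d \<ge> 2"
  shows "Min (Re ` op_spectrum d transpose_mat) \<le> -1"
proof -
  let ?X = "mat_unit d 0 1 - mat_unit d 1 0"
  have "?X $$ (0, 1) \<noteq> 0\<^sub>m d d $$ (0, 1)"
    using assms by (simp add: mat_unit_def)
  then have "?X \<noteq> 0\<^sub>m d d"
    by metis
  moreover have "transpose_mat ?X = (-1) \<cdot>\<^sub>m ?X"
    by (intro eq_matI) (auto simp: mat_unit_def)
  moreover have "?X \<in> carrier_mat d d"
    by (intro minus_carrier_mat mat_unit_carrier)
  ultimately have "-1 \<in> op_spectrum d transpose_mat"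
    unfolding op_spectrum_def by blast
  \<comment> \<open>Finiteness makes \<open>Min\<close> a true lower bound of the real
    parts.\<close>
  moreover have "finite (op_spectrum d transpose_mat)"
    using linear_op_transpose assms by (intro op_spectrum_finite_nonempty) auto
  ultimately show ?thesis
    by (intro Min_le) force+
qed

text \<open>The partial transpose of \<open>w w\<^sup>*\<close>, with \<open>w\<close> maximally entangled, is the swap operator,
  which is \<open>-1\<close> on the antisymmetric vector \<open>v\<close>.\<close>

lemma not_two_positive_transpose: "\<not> two_positive 2 transpose_mat"
proof
  assume pos: "two_positive 2 transpose_mat"
  \<comment> \<open>With index 2a + b for the tensor e_a e_b, \<open>w\<close> is the unnormalised
    sum of e_0 e_0 and e_1 e_1, and \<open>v\<close> is e_0 e_1 minus e_1 e_0.\<close>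
  define w :: "complex vec" where "w = vec 4 (\<lambda>i. if i = 0 \<or> i = 3 then 1 else 0)"
  define v :: "complex vec" where "v = vec 4 (\<lambda>i. if i = 1 then 1 else if i = 2 then -1 else 0)"
  define X where "X = mat 4 4 (\<lambda>(k, l). w $ k * cnj (w $ l))"
  define Y where "Y = id_tensor 2 2 transpose_mat X"
  have "psd 4 X"
    unfolding X_def by (rule psd_rank_one) (simp add: w_def)
  then have "psd 4 Y"
    using pos by (simp add: two_positive_def positive_map_def Y_def)
  then have "0 \<le> Re ((Y *\<^sub>v v) \<bullet>c v)"
    by (simp add: psd_def v_def)
  also have "(Y *\<^sub>v v) \<bullet>c v = (\<Sum>r<4. (\<Sum>c<4. Y $$ (r, c) * v $ c) * cnj (v $ r))"
    by (simp add: Y_def id_tensor_def v_def scalar_prod_def atLeast0LessThan)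
  also have "\<dots> = Y $$ (1, 1) - Y $$ (1, 2) - Y $$ (2, 1) + Y $$ (2, 2)"
    by (simp add: v_def eval_nat_numeral)
  \<comment> \<open>Transposing the blocks moves the entries of \<open>X\<close> at (0, 3) and (3,
    0) to (1, 2) and (2, 1), while both diagonal entries here are 0. The value is -1 times the
    squared norm 2 of \<open>v\<close>.\<close>
  also have "\<dots> = -2"
    by (simp add: Y_def id_tensor_def mat_block_def X_def w_def)
  finally show False
    by simp
qed

theorem mainTheorem4:
  shows "(\<exists>d \<ge> 2. \<exists>\<Phi> :: complex mat \<Rightarrow> complex mat.
            linear_op d \<Phi> \<and> positive_map d \<Phi> \<and> trace_preserving d \<Phi> \<and>
            Re (op_trace d \<Phi>) > real d * Min (Re ` op_spectrum d \<Phi>) + ((real d)\<^sup>2 - real d))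
       \<and> (linear_op 2 transpose_mat \<and> positive_map 2 transpose_mat \<and>
          trace_preserving 2 transpose_mat \<and>
          Re (op_trace 2 transpose_mat)
            > real 2 * Min (Re ` op_spectrum 2 transpose_mat) + ((real 2)\<^sup>2 - real 2) \<and>
          \<not> two_positive 2 transpose_mat)"
proof -
  \<comment> \<open>The left side is 2, the right side at most 2 * (-1) + (4 - 2) = 0.\<close>
  have "Re (op_trace 2 transpose_mat)
      > real 2 * Min (Re ` op_spectrum 2 transpose_mat) + ((real 2)\<^sup>2 - real 2)"
    using Min_spectrum_transpose_le[of 2] by (simp add: op_trace_transpose)
  then show ?thesis
    using linear_op_transpose positive_map_transpose trace_preserving_transpose
      not_two_positive_transpose by (intro conjI exI[of _ 2] exI[of _ transpose_mat]) simp_all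
qed

end
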